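(* Let $n\ge1$ and let $\varphi:\mathbb{B}^n\to\mathbb{B}^n$ be a holomorphic mapping. Suppose that the composition operator $C_\varphi$ is bounded below on $\mathcal{B}_{A(n,1)}$. Then there exist constants $\epsilon>0$ and $r\in(0,1)$ such that for every $w\in\mathbb{B}^n$ one can find a point $z_w\in\mathbb{B}^n$ satisfying $$\tanh\beta(\varphi(z_w),w)\leq r\quad\text{and}\quad\tau_{\varphi,n}(z_w)\geq\epsilon.$$
   Context: $\mathbb{B}^n=\{z\in\mathbb{C}^n:|z|<1\}$ is the open unit ball of $\mathbb{C}^n$ ($n\ge1$) with the standard Hermitian inner product $\langle z,w\rangle=\sum_i z_i\overline{w_i}$ and Euclidean norm $|z|$. For a holomorphic mapping $f:\mathbb{B}^n\to\mathbb{C}^n$ with complex Jacobian matrix $Df(z)$, define the prenorm $$\|f\|_{A(n,1)}=\sup_{z\in\mathbb{B}^n}(1-|z|^2)^{\frac{n+1}{2n}}|\det Df(z)|^{\frac1n}.$$ $\mathcal{B}_{A(n,1)}$ is the set of holomorphic mappings $f:\mathbb{B}^n\to\mathbb{C}^n$ with $\|f\|_{A(n,1)}<\infty$. For a holomorphic self-map $\varphi$ of $\mathbb{B}^n$, the composition operator is $C_\varphi f=f\circ\varphi$. It is bounded below on $\mathcal{B}_{A(n,1)}$ if there is a constant $k>0$ such that $\|C_\varphi f\|_{A(n,1)}\ge k\|f\|_{A(n,1)}$ for all $f\in\mathcal{B}_{A(n,1)}$. Furthermore, $$\tau_{\varphi,n}(z)=\left(\frac{1-|z|^2}{1-|\varphi(z)|^2}\right)^{\frac{n+1}{2n}}|\det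 D\varphi(z)|^{\frac1n},\qquad z\in\mathbb{B}^n.$$ Bergman metric: for $z\in\mathbb{B}^n$ let $B(z)=\frac{(1-|z|^2)I+A(z)}{(1-|z|^2)^2}$, where $I$ is the $n\times n$ identity matrix and $A(z)=(z_i\overline{z}_j)_{i,j}$. Then $\beta(z,w)=\inf_\gamma\int_0^1\langle B(\gamma(t))\gamma'(t),\gamma'(t)\rangle^{1/2}\,dt$, the infimum being over piecewise smooth curves $\gamma:[0,1]\to\mathbb{B}^n$ connecting $z$ and $w$. Equivalently, $\tanh\beta(z,w)=|\varphi_z(w)|$, where $\varphi_z$ is the involutive automorphism of $\mathbb{B}^n$ interchanging $0$ and $z$: $$\varphi_z(w)=\frac{z-P_zw-\sqrt{1-|z|^2}\,Q_zw}{1-\langle w,z\rangle},$$ with $P_z$ the orthogonal projection of $\mathbb{C}^n$ onto the span of $z$ and $Q_z=I-P_z$. *)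

theory Defs
  imports "HOL-Complex_Analysis.Complex_Analysis"
begin

text \<open>
  The space of \<open>n\<close>-tuples of complex numbers is \<^typ>\<open>complex ^ 'n\<close>, where \<open>n = CARD('n)\<close>; its
  library norm is the Euclidean norm, so the unit ball is \<open>ball 0 1\<close>.  A mapping on the ball is a
  total function of which only the values on the ball are used.
\<close>

definition herm :: "complex ^ 'n \<Rightarrow> complex ^ 'n \<Rightarrow> complex" where
  "herm z w = (\<Sum>i\<in>UNIV. z $ i * cnj (w $ i))"

text \<open>
  Complex differentiability at every point: the Frechet derivative exists and is complex linear.
\<close>

definition holomorphic_map_on ::
  "(complex ^ 'n \<Rightarrow> complex ^ 'n) \<Rightarrow> (complex ^ 'n) set \<Rightarrow> bool" where
  "holomorphic_map_on f S \<longleftrightarrow>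
     (\<forall>z\<in>S. \<exists>A :: complex ^ 'n ^ 'n. (f has_derivative (\<lambda>h. A *v h)) (at z within S))"

definition cjacobian :: "(complex ^ 'n \<Rightarrow> complex ^ 'n) \<Rightarrow> complex ^ 'n \<Rightarrow> complex ^ 'n ^ 'n" where
  "cjacobian f z = (\<chi> i j. deriv (\<lambda>t. f (z + axis j t) $ i) 0)"

lemma cjacobian_eq:
  fixes f :: "complex ^ 'n \<Rightarrow> complex ^ 'n" and A :: "complex ^ 'n ^ 'n"
  assumes "(f has_derivative (\<lambda>h. A *v h)) (at z)"
  shows "cjacobian f z = A"
proof -
  have "deriv (\<lambda>t. f (z + axis j t) $ i) 0 = A $ i $ j" for i j
  proof (rule DERIV_imp_deriv)
    have "bounded_linear (\<lambda>t. axis j t :: complex ^ 'n)"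
      unfolding linear_conv_bounded_linear[symmetric]
      by (rule linearI) (simp_all add: axis_def vec_eq_iff)
    then have "((\<lambda>t. z + axis j t) has_derivative (\<lambda>t. axis j t)) (at 0)"
      using has_derivative_add[OF has_derivative_const bounded_linear_imp_has_derivative] by fastforce
    moreover have "(f has_derivative (\<lambda>h. A *v h)) (at (z + axis j 0))"
      using assms by (simp add: axis_eq_0_iff[THEN iffD2])
    ultimately have "((\<lambda>t. f (z + axis j t)) has_derivative (\<lambda>t. A *v axis j t)) (at 0)"
      by (rule has_derivative_compose)
    then have "((\<lambda>t. f (z + axis j t) $ i) has_derivative (\<lambda>t. (A *v axis j t) $ i)) (at 0)"
      by (rule bounded_linear.has_derivative[OF bounded_linear_vec_nth])
    moreover have "(A *v axis j t) $ i = A $ i $ j * t" for t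
      by (simp add: matrix_vector_mult_def axis_def if_distrib cong: if_cong)
    ultimately show "((\<lambda>t. f (z + axis j t) $ i) has_field_derivative A $ i $ j) (at 0)"
      by (simp add: has_field_derivative_def)
  qed
  then show ?thesis
    by (simp add: cjacobian_def vec_eq_iff)
qed

text \<open>The prenorm takes values in \<^typ>\<open>ennreal\<close>, since the supremum may be infinite.\<close>

definition prenorm_A :: "(complex ^ 'n \<Rightarrow> complex ^ 'n) \<Rightarrow> ennreal" where
  "prenorm_A f = (SUP z\<in>ball 0 1. ennreal
     ((1 - (norm z)\<^sup>2) powr ((real CARD('n) + 1) / (2 * real CARD('n))) *
      cmod (det (cjacobian f z)) powr (1 / real CARD('n))))"

definition bloch_A :: "(complex ^ 'n \<Rightarrow> complex ^ 'n) set" where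
  "bloch_A = {f. holomorphic_map_on f (ball 0 1) \<and> prenorm_A f < \<infinity>}"

definition comp_bounded_below :: "(complex ^ 'n \<Rightarrow> complex ^ 'n) \<Rightarrow> bool" where
  "comp_bounded_below \<phi> \<longleftrightarrow>
     (\<exists>k::real. k > 0 \<and> (\<forall>f\<in>bloch_A. prenorm_A (f \<circ> \<phi>) \<ge> ennreal k * prenorm_A f))"

definition tau :: "(complex ^ 'n \<Rightarrow> complex ^ 'n) \<Rightarrow> complex ^ 'n \<Rightarrow> real" where
  "tau \<phi> z =
     ((1 - (norm z)\<^sup>2) / (1 - (norm (\<phi> z))\<^sup>2)) powr ((real CARD('n) + 1) / (2 * real CARD('n))) *
     cmod (det (cjacobian \<phi> z)) powr (1 / real CARD('n))"

definition bergman_matrix :: "complex ^ 'n \<Rightarrow> complex ^ 'n ^ 'n" where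
  "bergman_matrix z =
     (1 / (1 - (norm z)\<^sup>2)\<^sup>2) *\<^sub>R ((1 - (norm z)\<^sup>2) *\<^sub>R mat 1 + (\<chi> i j. z $ i * cnj (z $ j)))"

text \<open>
  The curve is \<open>C\<^sup>1\<close> on each closed interval of some partition of \<open>[0,1]\<close>, with one-sided
  derivatives at the partition points.  The library's \<^const>\<open>piecewise_C1_differentiable_on\<close>
  allows the derivative to be unbounded near the exceptional points, in which case the length
  integral need not exist and would be 0 by convention.
\<close>

definition piecewise_smooth_curve :: "(real \<Rightarrow> complex ^ 'n) \<Rightarrow> bool" where
  "piecewise_smooth_curve \<gamma> \<longleftrightarrow>
     (\<exists>(m::nat) (a :: nat \<Rightarrow> real). a 0 = 0 \<and> a m = 1 \<and>
        (\<forall>i<m. a i < a (Suc i) \<and>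
           (\<exists>D. continuous_on {a i..a (Suc i)} D \<and>
                (\<forall>t\<in>{a i..a (Suc i)}.
                   (\<gamma> has_vector_derivative D t) (at t within {a i..a (Suc i)})))))"

text \<open>
  The Hermitian form below is real and nonnegative on the ball; \<^const>\<open>Re\<close> only changes its type.
  The derivative of the curve may fail to exist at finitely many points, which do not affect the
  integral.
\<close>

definition bergman_length :: "(real \<Rightarrow> complex ^ 'n) \<Rightarrow> real" where
  "bergman_length \<gamma> = integral {0..1} (\<lambda>t.
     sqrt (Re (herm (bergman_matrix (\<gamma> t) *v vector_derivative \<gamma> (at t))
                    (vector_derivative \<gamma> (at t)))))"

definition bergman_dist :: "complex ^ 'n \<Rightarrow> complex ^ 'n \<Rightarrow> real" where
  "bergman_dist z w = (INF \<gamma>\<in>{\<gamma>. piecewise_smooth_curve \<gamma> \<and> \<gamma> ` {0..1} \<subseteq> ball 0 1 \<and>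
                                   \<gamma> 0 = z \<and> \<gamma> 1 = w}. bergman_length \<gamma>)"

end

theory Submission
  imports Defs
begin

text \<open>
  Test the lower bound on the automorphisms \<open>\<phi>\<^sub>w\<close>, which have prenorm 1, the supremum being attained
  at \<open>w\<close>.  Let \<open>p = (n + 1) / (2 n)\<close>.  By the chain rule, the expression under the supremum in the
  prenorm of \<open>\<phi>\<^sub>w \<circ> \<phi>\<close> is \<open>\<tau>(z) (1 - |\<phi>\<^sub>w(\<phi>(z))|\<^sup>2)\<^sup>p\<close>, so it exceeds \<open>k / 2\<close> at some \<open>z\<close>.
  Hence \<open>\<tau>(z) \<ge> k / 2\<close>.  Since \<open>\<tau>\<close> is bounded, by the Schwarz lemma applied to the map
  \<open>\<phi>\<^bsub>\<phi>(z)\<^esub> \<circ> \<phi> \<circ> \<phi>\<^sub>z\<close> fixing 0, the factor \<open>1 - |\<phi>\<^sub>w(\<phi>(z))|\<^sup>2\<close> is also bounded below, which bounds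
  the Bergman distance from \<open>\<phi>(z)\<close> to \<open>w\<close>.
\<close>

no_notation fps_nth (infixl "$" 75)

subsection \<open>Determinants\<close>

text \<open>The rows in \<open>T\<close> differ from unit rows only by multiples of row
  \<open>k\<close>, so the determinant is that of the identity with row \<open>k\<close> replaced by
  \<open>w\<close>.\<close>

lemma det_rank_one_update_aux:
  fixes v w :: "'a::field ^ 'n"
  assumes "finite T" "k \<notin> T"
  shows "det (\<chi> i. if i = k then w else if i \<in> T then axis i 1 + v $ i *s w else axis i 1) = w $ k"
  using assms
proof (induction T)
  case empty
  have row: "row i (mat 1 :: 'a ^ 'n ^ 'n) = axis i 1" for i
    by (simp add: vec_eq_iff row_def mat_def axis_def)
  have "(\<Sum>i\<in>UNIV. w $ i *s axis i 1) = w"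
    by (simp add: vec_eq_iff axis_def if_distrib cong: if_cong)
  then show ?case
    using cramer_lemma_transpose[of k w "mat 1"] by (simp add: row cong: if_cong)
next
  case (insert t T)
  define c where "c = (\<lambda>i. if i = k then w else if i \<in> T then axis i 1 + v $ i *s w else axis i 1)"
  have "det (\<chi> i. if i = k then w else if i \<in> insert t T then axis i 1 + v $ i *s w else axis i 1)
      = det (\<chi> i. if i = t then axis i 1 + v $ i *s w else c i)"
    using insert.prems by (intro arg_cong[of _ _ det]) (auto simp: vec_eq_iff c_def)
  also have "\<dots> = det (\<chi> i. if i = t then axis i 1 else c i) + det (\<chi> i. if i = t then v $ i *s w else c i)"
    by (rule det_row_add)
  also have "(\<chi> i. if i = t then v $ i *s w else c i) = (\<chi> i. if i = t then v $ t *s w else c i)"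
    by (simp add: vec_eq_iff)
  also have "det \<dots> = v $ t * det (\<chi> i. if i = t then w else c i)"
    by (rule det_row_mul)
  also have "det (\<chi> i. if i = t then w else c i) = 0"
    using insert.prems by (intro det_identical_rows[of t k]) (auto simp: row_def c_def)
  also have "(\<chi> i. if i = t then axis i 1 else c i) = (\<chi> i. c i)"
    using insert by (auto simp: vec_eq_iff c_def)
  also have "det (\<chi> i. c i) = w $ k"
    using insert by (simp add: c_def)
  finally show ?case by simp
qed

text \<open>The matrix determinant lemma. Rows are updated one at a time: multilinearity splits the
  new row \<open>k\<close> into a unit row, covered by the induction hypothesis, and
  \<open>v $ k\<close> times \<open>w\<close>, covered by the auxiliary lemma.\<close>

lemma det_rank_one_update:
  fixes v w :: "'a::field ^ 'n"
  shows "det (\<chi> i j. (if i = j then 1 else 0) + v $ i * w $ j) = 1 + (\<Sum>i\<in>UNIV. v $ i * w $ i)"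
proof -
  have "det (\<chi> i. if i \<in> S then axis i 1 + v $ i *s w else axis i 1) = 1 + (\<Sum>i\<in>S. v $ i * w $ i)"
    if "finite S" for S :: "'n set"
    using that
  proof (induction S)
    case empty
    have "(\<chi> i. axis i 1) = (mat 1 :: 'a ^ 'n ^ 'n)"
      by (simp add: vec_eq_iff mat_def axis_def)
    then show ?case by simp
  next
    case (insert k S)
    define c where "c = (\<lambda>i. if i \<in> S then axis i 1 + v $ i *s w else axis i 1)"
    have "det (\<chi> i. if i \<in> insert k S then axis i 1 + v $ i *s w else axis i 1)
        = det (\<chi> i. if i = k then axis i 1 + v $ i *s w else c i)"
      by (intro arg_cong[of _ _ det]) (auto simp: vec_eq_iff c_def)
    also have "\<dots> = det (\<chi> i. if i = k then axis i 1 else c i) + det (\<chi> i. if i = k then v $ i *s w else c i)"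
      by (rule det_row_add)
    also have "(\<chi> i. if i = k then v $ i *s w else c i) = (\<chi> i. if i = k then v $ k *s w else c i)"
      by (simp add: vec_eq_iff)
    also have "det \<dots> = v $ k * det (\<chi> i. if i = k then w else c i)"
      by (rule det_row_mul)
    also have "det (\<chi> i. if i = k then w else c i) = w $ k"
      unfolding c_def by (rule det_rank_one_update_aux[OF insert.hyps(1,2)])
    also have "(\<chi> i. if i = k then axis i 1 else c i) = (\<chi> i. c i)"
      using insert by (auto simp: vec_eq_iff c_def)
    also have "det (\<chi> i. c i) = 1 + (\<Sum>i\<in>S. v $ i * w $ i)"
      using insert by (simp add: c_def)
    finally show ?case
      using insert.hyps by simp
  qed
  from this[of UNIV]
  have "det (\<chi> i. axis i 1 + v $ i *s w) = 1 + (\<Sum>i\<in>UNIV. v $ i * w $ i)"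
    by simp
  moreover have "(\<chi> i. axis i 1 + v $ i *s w) = (\<chi> i j. (if i = j then 1 else 0) + v $ i * w $ j)"
    by (auto simp: vec_eq_iff axis_def)
  ultimately show ?thesis by simp
qed

text \<open>A crude Leibniz bound is enough, since the Schwarz-Pick estimate only has to produce
  some constant depending on the dimension.\<close>

lemma norm_det_le_fact:
  fixes A :: "complex ^ 'n ^ 'n"
  assumes "\<And>i j. norm (A $ i $ j) \<le> 1"
  shows "norm (det A) \<le> fact CARD('n)"
proof -
  have "norm (of_int (sign p) * (\<Prod>i\<in>UNIV. A $ i $ p i)) \<le> 1" for p :: "'n \<Rightarrow> 'n"
  proof -
    have "norm (of_int (sign p) :: complex) = 1"
      by (simp add: sign_def)
    moreover have "norm (\<Prod>i\<in>UNIV. A $ i $ p i) \<le> 1"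
      unfolding prod_norm[symmetric] by (rule prod_le_1) (simp add: assms)
    ultimately show ?thesis
      by (simp add: norm_mult)
  qed
  then have "norm (det A) \<le> of_nat (card {p. p permutes (UNIV :: 'n set)}) * 1"
    unfolding det_def by (intro sum_norm_bound)
  then show ?thesis
    by (simp add: card_permutations[OF refl])
qed

subsection \<open>Complex Euclidean space\<close>

lemma has_derivative_vec:
  fixes f :: "'a::real_normed_vector \<Rightarrow> 'b::euclidean_space ^ 'n"
  assumes "\<And>i. ((\<lambda>x. f x $ i) has_derivative (\<lambda>x. f' x $ i)) (at a within S)"
  shows "(f has_derivative f') (at a within S)"
proof (rule has_derivative_componentwise_within[THEN iffD2, OF ballI])
  fix b :: "'b ^ 'n" assume "b \<in> Basis"
  then obtain i u where b: "b = axis i u"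
    unfolding Basis_vec_def by blast
  have "((\<lambda>x. f x $ i \<bullet> u) has_derivative (\<lambda>x. f' x $ i \<bullet> u)) (at a within S)"
    by (rule has_derivative_inner_left[OF assms])
  then show "((\<lambda>x. f x \<bullet> b) has_derivative (\<lambda>x. f' x \<bullet> b)) (at a within S)"
    unfolding b inner_axis .
qed

lemma herm_add_left: "herm (x + y) z = herm x z + herm y z"
  and herm_diff_left: "herm (x - y) z = herm x z - herm y z"
  and herm_smult_left: "herm (c *s x) z = c * herm x z"
  and herm_scaleR_left: "herm (r *\<^sub>R x) z = of_real r * herm x z"
  and herm_diff_right: "herm z (x - y) = herm z x - herm z y"
  and herm_smult_right: "herm z (c *s x) = cnj c * herm z x"
  and herm_scaleR_right: "herm z (r *\<^sub>R x) = of_real r * herm z x"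
  and herm_zero_left [simp]: "herm 0 z = 0"
  by (simp_all add: herm_def distrib_left distrib_right left_diff_distrib right_diff_distrib sum.distrib
      sum_subtractf sum_distrib_left scaleR_conv_of_real[where 'a = complex] mult.assoc mult.left_commute)

lemma cnj_herm: "cnj (herm z w) = herm w z"
  by (simp add: herm_def mult.commute)

lemma herm_self: "herm z z = of_real ((norm z)\<^sup>2)"
proof -
  have "herm z z = of_real (\<Sum>i\<in>UNIV. (cmod (z $ i))\<^sup>2)"
    unfolding herm_def of_real_sum complex_norm_square ..
  then show ?thesis
    by (simp add: norm_vec_def L2_set_def sum_nonneg)
qed

lemma cmod_herm_le: "cmod (herm z w) \<le> norm z * norm w"
proof -
  have "cmod (herm z w) \<le> (\<Sum>i\<in>UNIV. \<bar>cmod (z $ i)\<bar> * \<bar>cmod (w $ i)\<bar>)"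
    unfolding herm_def by (rule order_trans[OF norm_sum]) (simp add: norm_mult)
  also have "\<dots> \<le> norm z * norm w"
    unfolding norm_vec_def by (rule L2_set_mult_ineq)
  finally show ?thesis .
qed

lemma norm_vector_smult: "norm (c *s z) = cmod c * norm (z :: complex ^ 'n)"
  by (simp add: norm_vec_def norm_mult L2_set_right_distrib)

lemma norm_diff_herm: "(norm (x - y))\<^sup>2 = (norm x)\<^sup>2 + (norm y)\<^sup>2 - 2 * Re (herm x y)"
proof -
  have "complex_of_real ((norm (x - y))\<^sup>2) = herm x x + herm y y - (herm x y + cnj (herm x y))"
    unfolding herm_self[symmetric] cnj_herm herm_diff_left herm_diff_right by simp
  also have "\<dots> = of_real ((norm x)\<^sup>2 + (norm y)\<^sup>2 - 2 * Re (herm x y))"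
    by (simp add: herm_self complex_add_cnj)
  finally show ?thesis
    using of_real_eq_iff by blast
qed

lemma bounded_linear_herm_left: "bounded_linear (\<lambda>z. herm z w)"
  unfolding linear_conv_bounded_linear[symmetric]
  by (rule linearI) (simp_all add: herm_add_left herm_scaleR_left scaleR_conv_of_real[where 'a = complex])

subsection \<open>Automorphisms of the ball\<close>

text \<open>
  With \<open>s = sqrt (1 - |w|\<^sup>2)\<close> the orthogonal projections in \<open>\<phi>\<^sub>w\<close> combine to
  \<open>P\<^sub>w u + s Q\<^sub>w u = s u + \<langle>u,w\<rangle> w / (1 + s)\<close>, which also makes sense at \<open>w = 0\<close>.
\<close>

definition ball_aut :: "complex ^ 'n \<Rightarrow> complex ^ 'n \<Rightarrow> complex ^ 'n" where
  "ball_aut w u = (let s = of_real (sqrt (1 - (norm w)\<^sup>2)); c = herm u w in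
     (1 / (1 - c)) *s ((1 - c / (1 + s)) *s w - s *s u))"

lemma one_minus_norm_square_pos: "norm z < 1 \<Longrightarrow> 0 < 1 - (norm z)\<^sup>2"
  by (simp add: abs_square_less_1)

text \<open>Cauchy-Schwarz bounds the modulus below by 1 - |u| |w|. Besides keeping denominators
  away from 0, this later compares 1 - |w|^2 and 1 - |u|^2 with |1 - <u,w>|.\<close>

lemma one_minus_herm_bounds:
  assumes "norm w < 1" "norm u < 1"
  shows "1 - norm w \<le> cmod (1 - herm u w)" "1 - norm u \<le> cmod (1 - herm u w)" "herm u w \<noteq> 1"
proof -
  have 1: "cmod (herm u w) \<le> norm u * norm w" by (rule cmod_herm_le)
  have 2: "1 - cmod (herm u w) \<le> cmod (1 - herm u w)"
    using norm_triangle_ineq2[of 1 "herm u w"] by simp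
  show "1 - norm w \<le> cmod (1 - herm u w)"
    using 1 2 assms mult_left_le_one_le[of "norm w" "norm u"] by simp
  show "1 - norm u \<le> cmod (1 - herm u w)"
    using 1 2 assms mult_left_le[of "norm w" "norm u"] by simp
  then show "herm u w \<noteq> 1"
    using assms by auto
qed

text \<open>The right-hand side is grouped so that its first factor is the quotient whose power is
  the modulus of the Jacobian determinant at \<open>u\<close>.\<close>

lemma ball_aut_norm:
  assumes "norm w < 1" "norm u < 1"
  shows "1 - (norm (ball_aut w u))\<^sup>2 = (1 - (norm w)\<^sup>2) / (cmod (1 - herm u w))\<^sup>2 * (1 - (norm u)\<^sup>2)"
proof -
  define s c where "s = sqrt (1 - (norm w)\<^sup>2)" and "c = herm u w"
  define a where "a = 1 - c / (1 + of_real s)"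
  have s: "0 < s" "s\<^sup>2 = 1 - (norm w)\<^sup>2"
    using one_minus_norm_square_pos[OF assms(1)] by (auto simp: s_def)
  have c: "1 - c \<noteq> 0"
    using one_minus_herm_bounds[OF assms] by (simp add: c_def)
  have a: "Re a = 1 - Re c / (1 + s)" "Im a = - Im c / (1 + s)"
    using s by (simp_all add: a_def complex_eq_iff Re_divide Im_divide field_simps power2_eq_square add_nonneg_eq_0_iff)
  have w: "(norm w)\<^sup>2 = (1 - s) * (1 + s)"
    using s by (simp add: algebra_simps power2_eq_square)
  have "(norm (a *s w - of_real s *s u))\<^sup>2 =
      (cmod a)\<^sup>2 * (norm w)\<^sup>2 + s\<^sup>2 * (norm u)\<^sup>2 - 2 * s * Re (a * cnj c)"
    using s(1) by (simp add: norm_diff_herm norm_vector_smult power_mult_distrib herm_smult_left herm_smult_right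
        c_def cnj_herm algebra_simps)
  also have "(cmod a)\<^sup>2 * (norm w)\<^sup>2 = (1 - s) * (1 + s - 2 * Re c + (cmod c)\<^sup>2 / (1 + s))"
  proof -
    \<comment> \<open>With the reciprocal as a variable, the identity is polynomial modulo
      \<open>(1 + s) * q = 1\<close>; the factor 1 + s of |w|^2 = (1 - s) (1 + s) absorbs the
      denominators.\<close>
    define q where "q = 1 / (1 + s)"
    have "(1 + s) * q = 1" using s(1) by (simp add: q_def)
    then have "((1 - Re c * q)\<^sup>2 + (Im c * q)\<^sup>2) * ((1 - s) * (1 + s)) =
        (1 - s) * (1 + s - 2 * Re c + ((Re c)\<^sup>2 + (Im c)\<^sup>2) * q)" by algebra
    then show ?thesis
      by (simp add: cmod_power2 a w q_def)
  qed
  also have "Re (a * cnj c) = Re c - (cmod c)\<^sup>2 / (1 + s)"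
    unfolding cmod_power2 by (simp add: a algebra_simps power2_eq_square add_divide_distrib)
  also have "(1 - s) * (1 + s - 2 * Re c + (cmod c)\<^sup>2 / (1 + s)) + s\<^sup>2 * (norm u)\<^sup>2
      - 2 * s * (Re c - (cmod c)\<^sup>2 / (1 + s)) = (cmod (1 - c))\<^sup>2 - s\<^sup>2 * (1 - (norm u)\<^sup>2)"
  proof -
    define K where "K = (cmod c)\<^sup>2 / (1 + s)"
    have "(1 + s) * K = (Re c)\<^sup>2 + (Im c)\<^sup>2"
      using s(1) by (simp add: K_def cmod_power2)
    then have "(cmod (1 - c))\<^sup>2 = 1 - 2 * Re c + (1 + s) * K"
      unfolding cmod_power2 by (simp add: power2_eq_square algebra_simps)
    then show ?thesis
      unfolding K_def[symmetric] by algebra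
  qed
  finally have "(norm (a *s w - of_real s *s u))\<^sup>2 = (cmod (1 - c))\<^sup>2 - s\<^sup>2 * (1 - (norm u)\<^sup>2)" .
  moreover have "ball_aut w u = (1 / (1 - c)) *s (a *s w - of_real s *s u)"
    by (simp add: ball_aut_def s_def c_def a_def Let_def)
  ultimately have "(norm (ball_aut w u))\<^sup>2 = ((cmod (1 - c))\<^sup>2 - s\<^sup>2 * (1 - (norm u)\<^sup>2)) / (cmod (1 - c))\<^sup>2"
    by (simp only: norm_vector_smult norm_divide power_mult_distrib power_divide norm_one one_power2 mult_1
        times_divide_eq_left)
  then show ?thesis
    using c by (simp add: s(2) c_def field_simps)
qed

lemma norm_ball_aut_less_1:
  assumes "norm w < 1" "norm u < 1"
  shows "norm (ball_aut w u) < 1"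
proof -
  have "0 < 1 - (norm (ball_aut w u))\<^sup>2"
    unfolding ball_aut_norm[OF assms] using assms one_minus_herm_bounds(3)[OF assms]
    by (intro mult_pos_pos divide_pos_pos one_minus_norm_square_pos) auto
  then show ?thesis
    by (simp add: abs_square_less_1)
qed

lemma ball_aut_0 [simp]: "ball_aut w 0 = w"
  by (simp add: ball_aut_def)

lemma ball_aut_self:
  assumes "norm w < 1" shows "ball_aut w w = 0"
proof -
  have pos: "0 < 1 - (norm w)\<^sup>2"
    by (rule one_minus_norm_square_pos[OF assms])
  have "cmod (1 - herm w w) = \<bar>1 - (norm w)\<^sup>2\<bar>"
    using norm_of_real[of "1 - (norm w)\<^sup>2", where 'a = complex] by (simp add: herm_self)
  then have "1 - (norm (ball_aut w w))\<^sup>2 = 1"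
    using pos unfolding ball_aut_norm[OF assms assms] by (simp add: power2_eq_square)
  then show ?thesis by simp
qed

text \<open>The quotient rule gives a scalar multiple of a rank-one update of the identity, k (I - v
  w^* / s) with k = -s / (1 - c). Its determinant is k^n s / (1 - c), of modulus (s / |1 -
  c|)^(n+1).\<close>

lemma ball_aut_has_derivative:
  fixes w u :: "complex ^ 'n"
  assumes "norm w < 1" "norm u < 1"
  obtains A :: "complex ^ 'n ^ 'n" where
    "(ball_aut w has_derivative (\<lambda>h. A *v h)) (at u)"
    "cmod (det A) = ((1 - (norm w)\<^sup>2) / (cmod (1 - herm u w))\<^sup>2) powr ((real CARD('n) + 1) / 2)"
proof -
  define s c where "s = sqrt (1 - (norm w)\<^sup>2)" and "c = herm u w"
  define N where "N = (\<lambda>i. (1 - c / (1 + of_real s)) * w $ i - of_real s * u $ i)"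
  \<comment> \<open>After factoring out 1 / (1 - c), the two terms are the coefficients of <h,w>
    coming from differentiating the numerator and the denominator.\<close>
  define v where "v = (\<chi> i. (- (w $ i) / (1 + of_real s) + N i / (1 - c)))"
  define A :: "complex ^ 'n ^ 'n"
    where "A = (\<chi> i j. ((if i = j then - of_real s else 0) + v $ i * cnj (w $ j)) / (1 - c))"
  have s: "0 < s" "s\<^sup>2 = 1 - (norm w)\<^sup>2"
    using one_minus_norm_square_pos[OF assms(1)] by (auto simp: s_def)
  have c: "1 - c \<noteq> 0"
    using one_minus_herm_bounds[OF assms] by (simp add: c_def)
  have s1: "1 + complex_of_real s \<noteq> 0"
    using s(1) by (auto simp: complex_eq_iff)
  have Av: "(A *v h) $ i = (- of_real s * h $ i + v $ i * herm h w) / (1 - c)" for h i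
  proof -
    have "(A *v h) $ i = (\<Sum>j\<in>UNIV. (if i = j then - of_real s * h $ j else 0) / (1 - c)
        + v $ i * (h $ j * cnj (w $ j)) / (1 - c))"
      unfolding matrix_vector_mult_def A_def by (auto intro!: sum.cong simp: add_divide_distrib algebra_simps)
    also have "\<dots> = - of_real s * h $ i / (1 - c) + v $ i * herm h w / (1 - c)"
      unfolding sum.distrib sum_divide_distrib[symmetric] herm_def sum_distrib_left by simp
    finally show ?thesis
      by (simp add: add_divide_distrib diff_divide_distrib)
  qed
  have "(ball_aut w has_derivative (\<lambda>h. A *v h)) (at u)"
  proof (rule has_derivative_vec)
    fix i
    have d: "((\<lambda>u. herm u w) has_derivative (\<lambda>h. herm h w)) (at u)"
      by (rule bounded_linear_imp_has_derivative[OF bounded_linear_herm_left])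
    have d2: "((\<lambda>u. u $ i) has_derivative (\<lambda>h. h $ i)) (at u)"
      by (rule bounded_linear_imp_has_derivative[OF bounded_linear_vec_nth])
    have num: "((\<lambda>u. (1 - herm u w / (1 + of_real s)) * w $ i - of_real s * u $ i)
        has_derivative (\<lambda>h. (0 - herm h w / (1 + of_real s)) * w $ i - of_real s * h $ i)) (at u)"
      by (intro has_derivative_diff has_derivative_const d d2 bounded_linear.has_derivative[OF bounded_linear_mult_left]
          bounded_linear.has_derivative[OF bounded_linear_mult_right] bounded_linear.has_derivative[OF bounded_linear_divide])
    have den: "((\<lambda>u. 1 - herm u w) has_derivative (\<lambda>h. 0 - herm h w)) (at u)"
      by (intro has_derivative_diff has_derivative_const d)
    have "((1 - herm u w / (1 + of_real s)) * w $ i - of_real s * u $ i) = N i"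
      by (simp add: N_def c_def)
    then have "((\<lambda>u. ((1 - herm u w / (1 + of_real s)) * w $ i - of_real s * u $ i) / (1 - herm u w))
      has_derivative (\<lambda>h. (((0 - herm h w / (1 + of_real s)) * w $ i - of_real s * h $ i) * (1 - c)
         - N i * (0 - herm h w)) / ((1 - c) * (1 - c)))) (at u)"
      using has_derivative_divide'[OF num den] c by (simp add: c_def)
    moreover have "(((0 - herm h w / (1 + of_real s)) * w $ i - of_real s * h $ i) * (1 - c)
         - N i * (0 - herm h w)) / ((1 - c) * (1 - c)) = (A *v h) $ i" for h
    proof -
      have "(P * (1 - c) - Q * (0 - X)) / ((1 - c) * (1 - c)) = P / (1 - c) + Q / (1 - c) * X / (1 - c)" for P Q X
        using c by (simp add: diff_divide_distrib add_divide_distrib)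
      moreover have "((0 - X / e) * W - S * H) / D + M / D * X / D = (- S * H + (- W / e + M / D) * X) / D"
        for X e W S H M D :: complex
        by (simp add: diff_divide_distrib add_divide_distrib left_diff_distrib distrib_right)
      moreover have "v $ i = - (w $ i) / (1 + of_real s) + N i / (1 - c)"
        by (simp add: v_def)
      ultimately show ?thesis
        unfolding Av by metis
    qed
    ultimately have "((\<lambda>u. ((1 - herm u w / (1 + of_real s)) * w $ i - of_real s * u $ i) / (1 - herm u w))
      has_derivative (\<lambda>h. (A *v h) $ i)) (at u)"
      by simp
    moreover have "ball_aut w u $ i = ((1 - herm u w / (1 + of_real s)) * w $ i - of_real s * u $ i) / (1 - herm u w)" for u
      by (simp only: ball_aut_def Let_def s_def vector_smult_component vector_minus_component times_divide_eq_left mult_1)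
    ultimately show "((\<lambda>x. ball_aut w x $ i) has_derivative (\<lambda>x. (A *v x) $ i)) (at u)"
      by simp
  qed
  moreover have "cmod (det A) = ((1 - (norm w)\<^sup>2) / (cmod (1 - herm u w))\<^sup>2) powr ((real CARD('n) + 1) / 2)"
  proof -
    define k where "k = - of_real s / (1 - c)"
    have k: "k * (- 1 / of_real s) = 1 / (1 - c)"
      using s(1) by (simp add: k_def)
    have "k * (E + (- 1 / of_real s * x) * y) = k * E + k * (- 1 / of_real s) * (x * y)" for E x y
      by (simp only: distrib_left mult.assoc)
    then have "k * (E + (- 1 / of_real s * x) * y) = (- of_real s * E + x * y) / (1 - c)" for E x y
      unfolding k by (simp add: k_def add_divide_distrib diff_divide_distrib)
    then have "A = (\<chi> i. k *s (\<chi> j. (if i = j then 1 else 0) + (- 1 / of_real s * v $ i) * cnj (w $ j)))"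
      unfolding vec_eq_iff A_def vec_lambda_beta vector_smult_component by simp
    then have "det A = k ^ CARD('n) *
        det (\<chi> i j. (if i = j then 1 else 0) + (\<chi> i. - 1 / of_real s * v $ i) $ i * (\<chi> j. cnj (w $ j)) $ j)"
      using det_rows_mul[of "\<lambda>_. k" "\<lambda>i. \<chi> j. (if i = j then 1 else 0) + (- 1 / of_real s * v $ i) * cnj (w $ j)"]
      by (simp only: prod_constant vec_lambda_beta)
    also have "\<dots> = k ^ CARD('n) * (1 + (\<Sum>i\<in>UNIV. - 1 / of_real s * v $ i * cnj (w $ i)))"
      unfolding det_rank_one_update by simp
    also have "(\<Sum>i\<in>UNIV. - 1 / of_real s * v $ i * cnj (w $ i)) = - 1 / of_real s * herm v w"
      by (simp only: herm_def sum_distrib_left mult.assoc)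
    \<comment> \<open>With this value the rank-one factor 1 - <v,w> / s collapses to s / (1 - c),
      which raises the exponent from n to n + 1.\<close>
    also have "herm v w = of_real s - of_real s ^ 2 / (1 - c)"
    proof -
      have v: "v = (- 1 / (1 + of_real s)) *s w + (1 / (1 - c)) *s ((1 - c / (1 + of_real s)) *s w - of_real s *s u)"
        by (simp only: v_def vec_eq_iff N_def vec_lambda_beta vector_add_component vector_smult_component
            vector_minus_component times_divide_eq_left mult_1 mult_minus1 simp_thms)
      have "herm v w = (- 1 / (1 + of_real s)) * herm w w
          + (1 / (1 - c)) * ((1 - c / (1 + of_real s)) * herm w w - of_real s * c)"
        by (simp only: v herm_add_left herm_diff_left herm_smult_left c_def)
      also have "herm w w = (1 - of_real s) * (1 + of_real s)"
      proof -
        have "(norm w)\<^sup>2 = (1 - s) * (1 + s)"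
          using s by (simp add: algebra_simps power2_eq_square)
        then show ?thesis
          unfolding herm_self by simp
      qed
      also have "(- 1 / (1 + of_real s)) * ((1 - of_real s) * (1 + of_real s))
          + (1 / (1 - c)) * ((1 - c / (1 + of_real s)) * ((1 - of_real s) * (1 + of_real s)) - of_real s * c)
         = of_real s - of_real s ^ 2 / (1 - c)"
      proof -
        define S q D where "S = complex_of_real s" and "q = 1 / (1 + S)" and "D = 1 / (1 - c)"
        have E: "q * ((1 - S) * (1 + S)) = 1 - S" and D: "D * (1 - c) = 1"
          using c s1 by (simp_all add: S_def q_def D_def)
        have "(1 - c * q) * ((1 - S) * (1 + S)) - S * c = (1 - S) * (1 + S) - c * (q * ((1 - S) * (1 + S))) - S * c"
          by (simp add: algebra_simps)
        also have "\<dots> = (1 - c) - S\<^sup>2"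
          unfolding E by (simp add: algebra_simps power2_eq_square)
        finally have "- (q * ((1 - S) * (1 + S))) + D * ((1 - c * q) * ((1 - S) * (1 + S)) - S * c)
          = - (1 - S) + (D * (1 - c) - D * S\<^sup>2)"
          by (simp only: E right_diff_distrib)
        then show ?thesis
          unfolding D by (simp add: S_def q_def D_def)
      qed
      finally show ?thesis .
    qed
    also have "1 + - 1 / of_real s * (of_real s - of_real s ^ 2 / (1 - c)) = of_real s / (1 - c)"
      using s(1) by (simp add: right_diff_distrib power2_eq_square)
    finally have "cmod (det A) = (s / cmod (1 - c)) ^ (CARD('n) + 1)"
      using s(1) by (simp add: norm_mult norm_power norm_divide k_def)
    \<comment> \<open>Passing to the square turns the square root \<open>s\<close> into 1 - |w|^2
      and halves the exponent.\<close>
    also have "\<dots> = ((s / cmod (1 - c))\<^sup>2) powr ((real CARD('n) + 1) / 2)"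
    proof -
      have "0 < s / cmod (1 - c)"
        using s(1) c by simp
      moreover from this have "(s / cmod (1 - c))\<^sup>2 = (s / cmod (1 - c)) powr 2"
        by simp
      moreover have "2 * ((real CARD('n) + 1) / 2) = real (CARD('n) + 1)"
        by simp
      ultimately show ?thesis
        by (simp only: powr_powr powr_realpow)
    qed
    finally show ?thesis
      by (simp add: s c_def power_divide)
  qed
  ultimately show thesis
    using that by blast
qed

text \<open>Taking the n-th root turns the exponent (n + 1) / 2 of the determinant into that of the
  weight, so the claim is the norm identity raised to this power. This invariance is what the
  exponent in the prenorm is made for.\<close>

lemma cmod_det_ball_aut_deriv:
  fixes w u :: "complex ^ 'n"
  assumes "norm w < 1" "norm u < 1"
    and "cmod d = ((1 - (norm w)\<^sup>2) / (cmod (1 - herm u w))\<^sup>2) powr ((real CARD('n) + 1) / 2)"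
  shows "(1 - (norm u)\<^sup>2) powr ((real CARD('n) + 1) / (2 * real CARD('n))) * cmod d powr (1 / real CARD('n))
    = (1 - (norm (ball_aut w u))\<^sup>2) powr ((real CARD('n) + 1) / (2 * real CARD('n)))"
proof -
  have "(real CARD('n) + 1) / 2 * (1 / real CARD('n)) = (real CARD('n) + 1) / (2 * real CARD('n))"
    by simp
  then show ?thesis
    unfolding ball_aut_norm[OF assms(1,2)] assms(3) powr_powr by (simp only: powr_mult mult.commute)
qed

subsection \<open>Schwarz--Pick estimate\<close>

lemma has_derivative_matrix_compose:
  fixes g :: "complex ^ 'm \<Rightarrow> complex ^ 'n" and f :: "complex ^ 'n \<Rightarrow> complex ^ 'k"
    and A :: "complex ^ 'm ^ 'n" and B :: "complex ^ 'n ^ 'k"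
  assumes "(g has_derivative (\<lambda>h. A *v h)) (at z)" "(f has_derivative (\<lambda>h. B *v h)) (at (g z))"
  shows "(f \<circ> g has_derivative (\<lambda>h. (B ** A) *v h)) (at z)"
  using diff_chain_at[OF assms] by (simp add: o_def matrix_vector_mul_assoc)

lemma holomorphic_map_on_openD:
  assumes "holomorphic_map_on f S" "open S" "z \<in> S"
  obtains A where "(f has_derivative (\<lambda>h. A *v h)) (at z)" "cjacobian f z = A"
  using assms cjacobian_eq at_within_open[of z S] unfolding holomorphic_map_on_def by metis

lemma holomorphic_map_onI:
  assumes "\<And>z. z \<in> S \<Longrightarrow> \<exists>A. (f has_derivative (\<lambda>h. A *v h)) (at z)"
  shows "holomorphic_map_on f S"
  using assms has_derivative_at_withinI unfolding holomorphic_map_on_def by blast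

lemma holomorphic_map_on_compose:
  assumes "holomorphic_map_on f T" "holomorphic_map_on g S" "open S" "open T" "g ` S \<subseteq> T"
  shows "holomorphic_map_on (f \<circ> g) S"
proof (rule holomorphic_map_onI)
  fix z assume z: "z \<in> S"
  obtain A where "(g has_derivative (\<lambda>h. A *v h)) (at z)"
    by (rule holomorphic_map_on_openD[OF assms(2,3) z])
  moreover obtain B where "(f has_derivative (\<lambda>h. B *v h)) (at (g z))"
    using assms(5) z by (auto intro: holomorphic_map_on_openD[OF assms(1,4), of "g z"])
  ultimately show "\<exists>A. (f \<circ> g has_derivative (\<lambda>h. A *v h)) (at z)"
    using has_derivative_matrix_compose by blast
qed

lemma holomorphic_map_on_ball_aut:
  assumes "norm w < 1" shows "holomorphic_map_on (ball_aut w) (ball 0 1)"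
  using ball_aut_has_derivative[OF assms] by (intro holomorphic_map_onI) (metis mem_ball_0)

text \<open>The \<open>i\<close>-th component of \<open>g\<close> along the \<open>j\<close>-th axis
  is a holomorphic self-map of the unit disc fixing 0, and the matrix entry is its derivative at 0;
  the one-variable Schwarz lemma applies.\<close>

lemma cjacobian_schwarz:
  fixes g :: "complex ^ 'n \<Rightarrow> complex ^ 'n"
  assumes g: "holomorphic_map_on g (ball 0 1)" "g ` ball 0 1 \<subseteq> ball 0 1" "g 0 = 0"
  shows "cmod (cjacobian g 0 $ i $ j) \<le> 1"
proof -
  have norm_axis: "norm (axis j t :: complex ^ 'n) = cmod t" for t
    by (simp add: norm_eq_sqrt_inner inner_axis_axis)
  have "bounded_linear (\<lambda>t. axis j t :: complex ^ 'n)"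
    unfolding linear_conv_bounded_linear[symmetric]
    by (rule linearI) (simp_all add: axis_def vec_eq_iff)
  then have ax: "((\<lambda>t. axis j t :: complex ^ 'n) has_derivative (\<lambda>t. axis j t)) (at t)" for t
    by (rule bounded_linear_imp_has_derivative)
  have "(\<lambda>t. g (axis j t) $ i) holomorphic_on ball 0 1"
  proof (rule holomorphic_onI)
    fix t :: complex assume "t \<in> ball 0 1"
    then have "axis j t \<in> ball (0 :: complex ^ 'n) 1"
      by (simp add: norm_axis)
    then obtain A where "(g has_derivative (\<lambda>h. A *v h)) (at (axis j t))"
      using holomorphic_map_on_openD[OF g(1) open_ball] by blast
    then have "((\<lambda>t. g (axis j t)) has_derivative (\<lambda>t. A *v axis j t)) (at t)"
      by (rule has_derivative_compose[OF ax])
    then have "((\<lambda>t. g (axis j t) $ i) has_derivative (\<lambda>t. (A *v axis j t) $ i)) (at t)"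
      by (rule bounded_linear.has_derivative[OF bounded_linear_vec_nth])
    moreover have "(A *v axis j t) $ i = A $ i $ j * t" for t
      by (simp add: matrix_vector_mult_def axis_def if_distrib cong: if_cong)
    ultimately have "((\<lambda>t. g (axis j t) $ i) has_field_derivative A $ i $ j) (at t)"
      by (simp add: has_field_derivative_def)
    then show "(\<lambda>t. g (axis j t) $ i) field_differentiable at t within ball 0 1"
      using field_differentiable_at_within field_differentiable_def by blast
  qed
  moreover have "g (axis j 0) $ i = 0"
    using g(3) by (simp add: axis_eq_0_iff[THEN iffD2])
  moreover have "cmod (g (axis j t) $ i) < 1" if "cmod t < 1" for t
  proof -
    have "g (axis j t) \<in> ball 0 1"
      using g(2) that by (auto simp: norm_axis image_subset_iff)
    then show ?thesis
      using Finite_Cartesian_Product.norm_nth_le[of "g (axis j t)" i] by simp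
  qed
  ultimately have "cmod (deriv (\<lambda>t. g (axis j t) $ i) 0) \<le> 1"
    by (intro Schwarz_Lemma(2)[of _ 0]) auto
  then show ?thesis
    by (simp add: cjacobian_def)
qed

text \<open>Automorphisms move \<open>z\<close> and its image \<open>a\<close> to the origin. The
  resulting map \<open>g\<close> fixes 0, and the n-th root of |det Dg(0)| is exactly
  \<open>tau \<phi> z\<close>.\<close>

lemma tau_le_fact:
  fixes \<phi> :: "complex ^ 'n \<Rightarrow> complex ^ 'n"
  assumes \<phi>: "holomorphic_map_on \<phi> (ball 0 1)" "\<phi> ` ball 0 1 \<subseteq> ball 0 1" and z: "norm z < 1"
  shows "tau \<phi> z \<le> fact CARD('n)"
proof -
  define a n where "a = \<phi> z" and "n = real CARD('n)"
  define g where "g = ball_aut a \<circ> (\<phi> \<circ> ball_aut z)"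
  have n: "n \<ge> 1"
    by (simp add: n_def Suc_leI)
  have a: "norm a < 1"
    using \<phi>(2) z by (auto simp: a_def image_subset_iff)
  have pos: "0 < 1 - (norm z)\<^sup>2" "0 < 1 - (norm a)\<^sup>2"
    using a z by (simp_all only: one_minus_norm_square_pos)
  have "holomorphic_map_on (\<phi> \<circ> ball_aut z) (ball 0 1)"
    using z norm_ball_aut_less_1[OF z]
    by (intro holomorphic_map_on_compose[OF \<phi>(1) holomorphic_map_on_ball_aut]) auto
  then have "holomorphic_map_on g (ball 0 1)"
    unfolding g_def using a norm_ball_aut_less_1[OF z] \<phi>(2)
    by (intro holomorphic_map_on_compose[OF holomorphic_map_on_ball_aut]) auto
  moreover have "g ` ball 0 1 \<subseteq> ball 0 1"
    unfolding g_def using norm_ball_aut_less_1[OF z] norm_ball_aut_less_1[OF a] \<phi>(2) by (auto simp: image_subset_iff)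
  moreover have "g 0 = 0"
    using ball_aut_self[OF a] by (simp add: g_def a_def)
  ultimately have "cmod (det (cjacobian g 0)) \<le> fact CARD('n)"
    by (intro norm_det_le_fact cjacobian_schwarz)
  then have "cmod (det (cjacobian g 0)) powr (1 / n) \<le> fact CARD('n) powr (1 / n)"
    by (intro powr_mono2) (use n in auto)
  \<comment> \<open>The n-th root does not increase n!, which is at least 1.\<close>
  also have "\<dots> \<le> fact CARD('n) powr 1"
    by (intro powr_mono) (use n in auto)
  finally have le: "cmod (det (cjacobian g 0)) powr (1 / n) \<le> fact CARD('n)"
    by simp
  obtain M1 :: "complex ^ 'n ^ 'n" where M1: "(ball_aut a has_derivative (\<lambda>h. M1 *v h)) (at a)"
    "cmod (det M1) = ((1 - (norm a)\<^sup>2) / (cmod (1 - herm a a))\<^sup>2) powr ((n + 1) / 2)"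
    unfolding n_def by (rule ball_aut_has_derivative[OF a a])
  obtain M2 :: "complex ^ 'n ^ 'n" where M2: "(ball_aut z has_derivative (\<lambda>h. M2 *v h)) (at 0)"
    "cmod (det M2) = ((1 - (norm z)\<^sup>2) / (cmod (1 - herm 0 z))\<^sup>2) powr ((n + 1) / 2)"
    unfolding n_def by (rule ball_aut_has_derivative[OF z, of 0]) auto
  obtain A where A: "(\<phi> has_derivative (\<lambda>h. A *v h)) (at z)" "cjacobian \<phi> z = A"
    using holomorphic_map_on_openD[OF \<phi>(1) open_ball, of z] z by auto
  have "(g has_derivative (\<lambda>h. (M1 ** (A ** M2)) *v h)) (at 0)"
    unfolding g_def using M1(1) M2(1) A(1) by (intro has_derivative_matrix_compose) (simp_all add: a_def)
  then have J: "cjacobian g 0 = M1 ** (A ** M2)"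
    by (rule cjacobian_eq)
  \<comment> \<open>The quotient in the determinant formula is 1 / (1 - |a|^2) for the outer
    automorphism at \<open>a\<close> and 1 - |z|^2 for the inner one at 0; their product is the
    quotient in \<open>tau\<close>.\<close>
  have "cmod (1 - herm a a) = 1 - (norm a)\<^sup>2"
    using norm_of_real[of "1 - (norm a)\<^sup>2", where 'a = complex] pos by (simp add: herm_self)
  then have "cmod (det M1) = (1 / (1 - (norm a)\<^sup>2)) powr ((n + 1) / 2)"
    unfolding M1(2) using pos by (simp add: power2_eq_square)
  moreover have "cmod (det M2) = (1 - (norm z)\<^sup>2) powr ((n + 1) / 2)"
    unfolding M2(2) by simp
  ultimately have "cmod (det (cjacobian g 0)) = 
      ((1 / (1 - (norm a)\<^sup>2)) powr ((n + 1) / 2) * (1 - (norm z)\<^sup>2) powr ((n + 1) / 2)) * cmod (det A)"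
    by (simp add: J det_mul norm_mult)
  also have "\<dots> = ((1 - (norm z)\<^sup>2) / (1 - (norm a)\<^sup>2)) powr ((n + 1) / 2) * cmod (det A)"
    using pos by (simp add: powr_mult[symmetric])
  finally have "cmod (det (cjacobian g 0)) powr (1 / n) =
     ((1 - (norm z)\<^sup>2) / (1 - (norm a)\<^sup>2)) powr ((n + 1) / 2 * (1 / n)) * cmod (det A) powr (1 / n)"
    using pos by (simp only: powr_mult powr_powr)
  also have "(n + 1) / 2 * (1 / n) = (n + 1) / (2 * n)"
    by simp
  also have "((1 - (norm z)\<^sup>2) / (1 - (norm a)\<^sup>2)) powr ((n + 1) / (2 * n)) * cmod (det A) powr (1 / n) = tau \<phi> z"
    by (simp add: tau_def n_def a_def A(2))
  finally show ?thesis
    using le by simp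
qed

subsection \<open>Bergman distance\<close>

text \<open>The rank-one part of the matrix sends \<open>h\<close> to <h,z> z. The two resulting
  terms are estimated separately along the segment below.\<close>

lemma herm_bergman_matrix:
  fixes z h :: "complex ^ 'a"
  assumes "norm z < 1"
  shows "Re (herm (bergman_matrix z *v h) h) =
    (norm h)\<^sup>2 / (1 - (norm z)\<^sup>2) + (cmod (herm h z))\<^sup>2 / (1 - (norm z)\<^sup>2)\<^sup>2"
proof -
  define \<delta> where "\<delta> = 1 - (norm z)\<^sup>2"
  have \<delta>: "\<delta> > 0"
    using one_minus_norm_square_pos[OF assms] by (simp add: \<delta>_def)
  have "bergman_matrix z *v h = (1 / \<delta>\<^sup>2) *\<^sub>R (\<delta> *\<^sub>R h + herm h z *s z)"
  proof -
    have "(\<chi> i j. z $ i * cnj (z $ j)) *v h = herm h z *s z"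
      by (simp add: vec_eq_iff matrix_vector_mult_def herm_def sum_distrib_left mult_ac)
    moreover have "(r *\<^sub>R M) *v h = r *\<^sub>R (M *v h)" for r and M :: "complex ^ 'a ^ 'a"
      by (simp add: vec_eq_iff matrix_vector_mult_def scaleR_sum_right)
    ultimately show ?thesis
      unfolding bergman_matrix_def \<delta>_def[symmetric] by (simp add: matrix_vector_mult_add_rdistrib)
  qed
  then have "herm (bergman_matrix z *v h) h = of_real (1 / \<delta>\<^sup>2) * (of_real \<delta> * herm h h + herm h z * herm z h)"
    by (simp only: herm_scaleR_left herm_add_left herm_smult_left)
  also have "herm h z * herm z h = of_real ((cmod (herm h z))\<^sup>2)"
    unfolding cnj_herm[of h z, symmetric] complex_norm_square ..
  also have "of_real (1 / \<delta>\<^sup>2) * (of_real \<delta> * herm h h + of_real ((cmod (herm h z))\<^sup>2))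
    = complex_of_real (1 / \<delta>\<^sup>2 * (\<delta> * (norm h)\<^sup>2 + (cmod (herm h z))\<^sup>2))"
    unfolding herm_self of_real_mult of_real_add ..
  also have "1 / \<delta>\<^sup>2 * (\<delta> * (norm h)\<^sup>2 + (cmod (herm h z))\<^sup>2) = (norm h)\<^sup>2 / \<delta> + (cmod (herm h z))\<^sup>2 / \<delta>\<^sup>2"
    using \<delta> by (simp add: field_simps power2_eq_square)
  finally show ?thesis
    by (simp add: \<delta>_def)
qed

lemma herm_bergman_matrix_nonneg:
  assumes "norm z < 1"
  shows "0 \<le> Re (herm (bergman_matrix z *v h) h)"
  unfolding herm_bergman_matrix[OF assms] using one_minus_norm_square_pos[OF assms] by simp

text \<open>Integrability is not assumed: otherwise the integral is 0 by convention. Nonnegativity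
  bounds the lengths below, so that the real infimum in \<open>bergman_dist\<close> is
  meaningful.\<close>

lemma bergman_length_nonneg:
  assumes "\<gamma> ` {0..1} \<subseteq> ball 0 1"
  shows "0 \<le> bergman_length \<gamma>"
proof -
  define F where "F = (\<lambda>t. sqrt (Re (herm (bergman_matrix (\<gamma> t) *v vector_derivative \<gamma> (at t))
                    (vector_derivative \<gamma> (at t)))))"
  have "0 \<le> F t" if "t \<in> {0..1}" for t
    using assms that unfolding F_def
    by (intro real_sqrt_ge_zero herm_bergman_matrix_nonneg) (auto simp: image_subset_iff)
  then show ?thesis
    unfolding bergman_length_def F_def[symmetric]
    using Henstock_Kurzweil_Integration.integral_nonneg[of F "{0..1}"] not_integrable_integral[of F "{0..1}"]
    by fastforce
qed

text \<open>The default integral 0 is also at most \<open>C\<close>, so a pointwise bound on the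
  speed suffices.\<close>

lemma bergman_length_le:
  assumes "0 \<le> C" "\<And>t. t \<in> {0..1} \<Longrightarrow> Re (herm (bergman_matrix (\<gamma> t) *v vector_derivative \<gamma> (at t))
                    (vector_derivative \<gamma> (at t))) \<le> C\<^sup>2"
  shows "bergman_length \<gamma> \<le> C"
proof -
  define F where "F = (\<lambda>t. sqrt (Re (herm (bergman_matrix (\<gamma> t) *v vector_derivative \<gamma> (at t))
                    (vector_derivative \<gamma> (at t)))))"
  have F: "F t \<le> C" if "t \<in> {0..1}" for t
    unfolding F_def using assms that by (intro real_le_lsqrt) auto
  show ?thesis
    unfolding bergman_length_def F_def[symmetric]
  proof (cases "F integrable_on {0..1}")
    case True
    then have "integral {0..1} F \<le> integral {0..1} (\<lambda>_::real. C)"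
      by (rule Henstock_Kurzweil_Integration.integral_le) (auto simp: F)
    then show "integral {0..1} F \<le> C" by simp
  qed (use assms(1) in \<open>simp add: not_integrable_integral\<close>)
qed

lemma bergman_dist_le:
  assumes "piecewise_smooth_curve \<gamma>" "\<gamma> ` {0..1} \<subseteq> ball 0 1" "\<gamma> 0 = z" "\<gamma> 1 = w"
  shows "bergman_dist z w \<le> bergman_length \<gamma>"
  unfolding bergman_dist_def
proof (rule cINF_lower)
  show "bdd_below (bergman_length ` {\<gamma>. piecewise_smooth_curve \<gamma> \<and> \<gamma> ` {0..1} \<subseteq> ball 0 1 \<and> \<gamma> 0 = z \<and> \<gamma> 1 = w})"
    by (rule bdd_belowI[of _ 0]) (auto intro: bergman_length_nonneg)
qed (use assms in simp)

text \<open>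
  The straight segment from \<open>a\<close> to \<open>w\<close> is already short enough: with \<open>\<kappa> = |1 - \<langle>a,w\<rangle>|\<close>, along it
  \<open>1 - |\<gamma>|\<^sup>2\<close> is at least a multiple of \<open>\<kappa>\<close>, while \<open>|\<gamma>'|\<^sup>2\<close> and \<open>|\<langle>\<gamma>',\<gamma>\<rangle>|\<close> are at most multiples of \<open>\<kappa>\<close>.
\<close>

lemma bergman_dist_le_ball_aut:
  assumes a: "norm a < 1" and w: "norm w < 1" and \<eta>: "0 < \<eta>" "\<eta> \<le> 1 - (norm (ball_aut w a))\<^sup>2"
  shows "bergman_dist a w \<le> sqrt (4 / \<eta> + 100 / \<eta>\<^sup>2)"
proof -
  define \<delta> \<alpha> \<kappa> where "\<delta> = 1 - (norm w)\<^sup>2" and "\<alpha> = 1 - (norm a)\<^sup>2" and "\<kappa> = cmod (1 - herm a w)"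
  define d where "d = w - a"
  define \<gamma> where "\<gamma> = (\<lambda>t. a + t *\<^sub>R d)"
  have pos: "0 < \<delta>" "0 < \<alpha>"
    using a w by (simp_all only: one_minus_norm_square_pos \<delta>_def \<alpha>_def)
  note b = one_minus_herm_bounds[OF w a, folded \<kappa>_def]
  have \<kappa>: "0 < \<kappa>"
    using b(3) by (simp add: \<kappa>_def)
  have le2: "1 - x\<^sup>2 \<le> 2 * (1 - x)" for x :: real
    using zero_le_power2[of "1 - x"] by (simp add: power2_eq_square algebra_simps)
  have \<delta>2: "\<delta> \<le> 2 * \<kappa>" and \<alpha>2: "\<alpha> \<le> 2 * \<kappa>"
    using le2[of "norm w"] le2[of "norm a"] b(1,2) by (simp_all add: \<delta>_def \<alpha>_def)
  have "\<eta> \<le> \<delta> / \<kappa>\<^sup>2 * \<alpha>"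
    using \<eta>(2) unfolding ball_aut_norm[OF w a] \<delta>_def \<alpha>_def \<kappa>_def .
  then have *: "\<eta> * \<kappa>\<^sup>2 \<le> \<delta> * \<alpha>"
    using \<kappa> by (simp add: field_simps)
  \<comment> \<open>Both \<delta> and \<alpha> are at most 2 \<kappa>, so the lower bound on their
    product forces each of them to be at least a multiple of \<kappa>.\<close>
  have half: "\<eta> * \<kappa> / 2 \<le> x" if "\<eta> * \<kappa>\<^sup>2 \<le> x * y" "y \<le> 2 * \<kappa>" "0 < x" for x y
  proof -
    have "\<eta> * \<kappa>\<^sup>2 \<le> x * (2 * \<kappa>)"
      using that mult_left_mono[of y "2 * \<kappa>" x] by linarith
    then have "\<kappa> * (\<eta> * \<kappa>) \<le> \<kappa> * (2 * x)"
      by (simp only: power2_eq_square mult_ac)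
    then show ?thesis
      using \<kappa> by simp
  qed
  have \<delta>: "\<eta> * \<kappa> / 2 \<le> \<delta>"
    by (rule half[OF * \<alpha>2 pos(1)])
  have \<alpha>: "\<eta> * \<kappa> / 2 \<le> \<alpha>"
    using * by (intro half[OF _ \<delta>2 pos(2)]) (simp only: mult.commute)
  have \<gamma>_norm: "\<eta> * \<kappa> / 2 \<le> 1 - (norm (\<gamma> t))\<^sup>2" if "t \<in> {0..1}" for t
  proof -
    \<comment> \<open>Both endpoints lie in the closed ball of radius \<open>R\<close>; by convexity
      so does the segment.\<close>
    define R where "R = sqrt (1 - \<eta> * \<kappa> / 2)"
    have R: "0 \<le> 1 - \<eta> * \<kappa> / 2"
      using \<alpha> zero_le_power2[of "norm a"] unfolding \<alpha>_def by linarith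
    have "norm a \<le> R" "norm w \<le> R"
      using \<alpha> \<delta> unfolding R_def \<alpha>_def \<delta>_def by (auto intro!: real_le_rsqrt)
    then have "closed_segment a w \<subseteq> cball 0 R"
      by (intro closed_segment_subset) auto
    moreover have "\<gamma> t \<in> closed_segment a w"
      using that by (auto simp: \<gamma>_def d_def closed_segment_def algebra_simps intro!: exI[of _ t])
    ultimately have "norm (\<gamma> t) \<le> R" by auto
    then have "(norm (\<gamma> t))\<^sup>2 \<le> R\<^sup>2"
      by (intro power_mono) auto
    then show ?thesis
      using R by (simp add: R_def)
  qed
  have \<gamma>_ball: "norm (\<gamma> t) < 1" if "t \<in> {0..1}" for t
  proof -
    have "0 < \<eta> * \<kappa> / 2" using \<eta> \<kappa> by simp
    then have "(norm (\<gamma> t))\<^sup>2 < 1"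
      using \<gamma>_norm[OF that] by linarith
    then show ?thesis
      by (simp add: abs_square_less_1)
  qed
  have deriv: "(\<gamma> has_vector_derivative d) (at t within S)" for t S
    unfolding \<gamma>_def by (auto intro!: derivative_eq_intros)
  have smooth: "piecewise_smooth_curve \<gamma>"
    unfolding piecewise_smooth_curve_def
    by (rule exI[of _ 1], rule exI[of _ real]) (auto intro!: exI[of _ "\<lambda>_. d"] deriv)
  \<comment> \<open>Here |d|^2 = 2 (1 - Re <a,w>) - \<alpha> - \<delta>, and the subtracted terms
    are positive.\<close>
  have "1 - Re (herm a w) \<le> \<kappa>"
    unfolding \<kappa>_def using complex_Re_le_cmod[of "1 - herm a w"] by simp
  then have d2: "(norm d)\<^sup>2 \<le> 2 * \<kappa>"
    using norm_diff_herm[of a w] pos unfolding d_def norm_minus_commute[of w a] \<alpha>_def \<delta>_def by linarith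
  have "herm d w = (1 - herm a w) - of_real \<delta>"
    by (simp add: d_def herm_diff_left herm_self \<delta>_def)
  then have "cmod (herm d w) \<le> cmod (1 - herm a w) + cmod (of_real \<delta>)"
    by (simp only: norm_triangle_ineq4)
  then have dw: "cmod (herm d w) \<le> 3 * \<kappa>"
    using \<delta>2 pos by (simp add: \<kappa>_def)
  have "Re (herm (bergman_matrix (\<gamma> t) *v d) d) \<le> 4 / \<eta> + 100 / \<eta>\<^sup>2" if t: "t \<in> {0..1}" for t
  proof -
    \<comment> \<open>Expanding around the endpoint \<open>w\<close> gives |<d,\<gamma>(t)>| \<le> 3
      \<kappa> + 2 \<kappa>.\<close>
    have "\<gamma> t = w - (1 - t) *\<^sub>R d"
      by (simp add: \<gamma>_def d_def algebra_simps)
    then have "herm d (\<gamma> t) = herm d w - of_real ((1 - t) * (norm d)\<^sup>2)"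
      by (simp add: herm_diff_right herm_scaleR_right herm_self)
    then have "cmod (herm d (\<gamma> t)) \<le> cmod (herm d w) + cmod (of_real ((1 - t) * (norm d)\<^sup>2))"
      by (simp only: norm_triangle_ineq4)
    also have "cmod (of_real ((1 - t) * (norm d)\<^sup>2)) = (1 - t) * (norm d)\<^sup>2"
      unfolding norm_of_real using t by (intro abs_of_nonneg) simp
    also have "(1 - t) * (norm d)\<^sup>2 \<le> 1 * (2 * \<kappa>)"
      using t d2 by (intro mult_mono) auto
    finally have "cmod (herm d (\<gamma> t)) \<le> 5 * \<kappa>"
      using dw by simp
    then have 2: "(cmod (herm d (\<gamma> t)))\<^sup>2 \<le> (5 * \<kappa>)\<^sup>2"
      by (intro power_mono) auto
    have 0: "0 < \<eta> * \<kappa> / 2" using \<eta> \<kappa> by simp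
    \<comment> \<open>Now \<kappa> cancels, so the bound depends on \<eta> alone and is uniform in
      the endpoints.\<close>
    have "Re (herm (bergman_matrix (\<gamma> t) *v d) d) \<le> 2 * \<kappa> / (\<eta> * \<kappa> / 2) + (5 * \<kappa>)\<^sup>2 / (\<eta> * \<kappa> / 2)\<^sup>2"
      unfolding herm_bergman_matrix[OF \<gamma>_ball[OF t]]
      using 0 \<kappa> by (intro add_mono frac_le power_mono \<gamma>_norm[OF t] d2 2 zero_less_power) auto
    also have "\<dots> = 4 / \<eta> + 100 / \<eta>\<^sup>2"
      using \<kappa> \<eta> by (simp add: field_simps power2_eq_square)
    finally show ?thesis .
  qed
  then have "bergman_length \<gamma> \<le> sqrt (4 / \<eta> + 100 / \<eta>\<^sup>2)"
    using \<eta>(1) by (intro bergman_length_le) (simp_all add: vector_derivative_at[OF deriv])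
  moreover have "bergman_dist a w \<le> bergman_length \<gamma>"
    using smooth \<gamma>_ball by (intro bergman_dist_le) (auto simp: \<gamma>_def d_def)
  ultimately show ?thesis by simp
qed

subsection \<open>Automorphisms as test functions\<close>

text \<open>By invariance the expression under the supremum at \<open>u\<close> is a positive power
  of 1 - |\<open>ball_aut w u\<close>|^2: at most 1, and equal to 1 at \<open>u = w\<close>, which
  is sent to 0.\<close>

lemma ball_aut_in_bloch_A:
  fixes w :: "complex ^ 'n"
  assumes "norm w < 1"
  shows "ball_aut w \<in> bloch_A" "1 \<le> prenorm_A (ball_aut w)"
proof -
  define n p where "n = real CARD('n)" and "p = (n + 1) / (2 * n)"
  have p: "0 < p"
    by (simp add: p_def n_def add_nonneg_pos)
  have eq: "(1 - (norm u)\<^sup>2) powr p * cmod (det (cjacobian (ball_aut w) u)) powr (1 / n) = (1 - (norm (ball_aut w u))\<^sup>2) powr p"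
    if u: "norm u < 1" for u
  proof (rule ball_aut_has_derivative[OF assms u])
    fix A :: "complex ^ 'n ^ 'n"
    assume A: "(ball_aut w has_derivative (\<lambda>h. A *v h)) (at u)"
      "cmod (det A) = ((1 - (norm w)\<^sup>2) / (cmod (1 - herm u w))\<^sup>2) powr ((real CARD('n) + 1) / 2)"
    show ?thesis
      using cmod_det_ball_aut_deriv[OF assms u A(2)] by (simp only: cjacobian_eq[OF A(1)] p_def n_def)
  qed
  have "(1 - (norm (ball_aut w u))\<^sup>2) powr p \<le> 1" if "norm u < 1" for u
    using powr_mono2[of p "1 - (norm (ball_aut w u))\<^sup>2" 1] p one_minus_norm_square_pos[OF norm_ball_aut_less_1[OF assms that]]
    by simp
  then have "prenorm_A (ball_aut w) \<le> 1"
    unfolding prenorm_A_def n_def[symmetric] p_def[symmetric]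
    by (intro SUP_least) (simp add: eq)
  then have "prenorm_A (ball_aut w) < \<infinity>"
    by (rule order.strict_trans1) simp
  then show "ball_aut w \<in> bloch_A"
    using holomorphic_map_on_ball_aut[OF assms] by (simp add: bloch_A_def)
  show "1 \<le> prenorm_A (ball_aut w)"
    unfolding prenorm_A_def n_def[symmetric] p_def[symmetric]
    by (rule SUP_upper2[of w]) (use assms in \<open>simp_all add: eq ball_aut_self\<close>)
qed

text \<open>Invariance at \<open>\<phi> z\<close> evaluates the outer determinant in the chain rule;
  the power of 1 - |\<phi>(z)|^2 it brings in is the denominator in \<open>tau\<close>.\<close>

lemma weight_compose_ball_aut:
  fixes \<phi> :: "complex ^ 'n \<Rightarrow> complex ^ 'n"
  assumes \<phi>: "holomorphic_map_on \<phi> (ball 0 1)" "\<phi> ` ball 0 1 \<subseteq> ball 0 1" and z: "norm z < 1" and w: "norm w < 1"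
  shows "(1 - (norm z)\<^sup>2) powr ((real CARD('n) + 1) / (2 * real CARD('n))) *
      cmod (det (cjacobian (ball_aut w \<circ> \<phi>) z)) powr (1 / real CARD('n))
    = tau \<phi> z * (1 - (norm (ball_aut w (\<phi> z)))\<^sup>2) powr ((real CARD('n) + 1) / (2 * real CARD('n)))"
proof -
  define n p where "n = real CARD('n)" and "p = (n + 1) / (2 * n)"
  have a: "norm (\<phi> z) < 1"
    using \<phi>(2) z by (auto simp: image_subset_iff)
  have pos: "0 < 1 - (norm (\<phi> z))\<^sup>2"
    by (rule one_minus_norm_square_pos[OF a])
  obtain B :: "complex ^ 'n ^ 'n" where B: "(ball_aut w has_derivative (\<lambda>h. B *v h)) (at (\<phi> z))"
    "cmod (det B) = ((1 - (norm w)\<^sup>2) / (cmod (1 - herm (\<phi> z) w))\<^sup>2) powr ((real CARD('n) + 1) / 2)"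
    by (rule ball_aut_has_derivative[OF w a])
  obtain A where A: "(\<phi> has_derivative (\<lambda>h. A *v h)) (at z)" "cjacobian \<phi> z = A"
    using holomorphic_map_on_openD[OF \<phi>(1) open_ball, of z] z by auto
  have J: "cjacobian (ball_aut w \<circ> \<phi>) z = B ** A"
    by (rule cjacobian_eq[OF has_derivative_matrix_compose[OF A(1) B(1)]])
  have "tau \<phi> z * (1 - (norm (ball_aut w (\<phi> z)))\<^sup>2) powr p =
    tau \<phi> z * ((1 - (norm (\<phi> z))\<^sup>2) powr p * cmod (det B) powr (1 / n))"
    using cmod_det_ball_aut_deriv[OF w a B(2)] by (simp only: p_def n_def)
  also have "\<dots> = (1 - (norm z)\<^sup>2) powr p * (cmod (det B) powr (1 / n) * cmod (det A) powr (1 / n))"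
    using pos by (simp add: tau_def A(2) powr_divide flip: n_def p_def)
  also have "cmod (det B) powr (1 / n) * cmod (det A) powr (1 / n) = cmod (det (B ** A)) powr (1 / n)"
    by (simp only: det_mul norm_mult powr_mult)
  finally show ?thesis
    by (simp only: J p_def n_def)
qed

theorem theorem3p4:
  fixes \<phi> :: "complex ^ 'n \<Rightarrow> complex ^ 'n"
  assumes "holomorphic_map_on \<phi> (ball 0 1)"
    and "\<phi> ` ball 0 1 \<subseteq> ball 0 1"
    and "comp_bounded_below \<phi>"
  shows "\<exists>\<epsilon> r :: real. \<epsilon> > 0 \<and> 0 < r \<and> r < 1 \<and>
           (\<forall>w\<in>ball 0 1. \<exists>z\<in>ball 0 1. tanh (bergman_dist (\<phi> z) w) \<le> r \<and> tau \<phi> z \<ge> \<epsilon>)"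
proof -
  define p where "p = (real CARD('n) + 1) / (2 * real CARD('n))"
  define F :: real where "F = fact CARD('n)"
  have p: "0 < p"
    by (simp add: p_def add_nonneg_pos)
  have F: "0 < F"
    by (simp add: F_def)
  obtain k where k: "0 < k" "\<And>f. f \<in> bloch_A \<Longrightarrow> prenorm_A (f \<circ> \<phi>) \<ge> ennreal k * prenorm_A f"
    using assms(3) unfolding comp_bounded_below_def by blast
  \<comment> \<open>The solution of F \<eta>^p = k / 2, where \<open>F\<close> is the upper bound
    for \<open>tau\<close>.\<close>
  define \<eta> where "\<eta> = (k / 2 / F) powr (1 / p)"
  \<comment> \<open>The distance bound belonging to \<eta>; it does not depend on \<open>w\<close>,
    so \<open>tanh C\<close> serves as \<open>r\<close>.\<close>
  define C where "C = sqrt (4 / \<eta> + 100 / \<eta>\<^sup>2)"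
  have \<eta>: "0 < \<eta>"
    using k(1) F by (simp add: \<eta>_def)
  then have C: "0 < C"
    by (simp add: C_def add_pos_pos)
  have "\<exists>z\<in>ball 0 1. tanh (bergman_dist (\<phi> z) w) \<le> tanh C \<and> k / 2 \<le> tau \<phi> z" if "w \<in> ball 0 1" for w
  proof -
    have w: "norm w < 1"
      using that by simp
    \<comment> \<open>The supremum need not be attained; halving \<open>k\<close> makes the
      inequality strict, so some \<open>z\<close> exceeds \<open>k / 2\<close>.\<close>
    have "ennreal (k / 2) < ennreal k * 1"
      using k(1) by (simp add: ennreal_less_iff)
    also have "\<dots> \<le> ennreal k * prenorm_A (ball_aut w)"
      by (intro mult_left_mono ball_aut_in_bloch_A w) simp
    also have "\<dots> \<le> prenorm_A (ball_aut w \<circ> \<phi>)"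
      by (intro k ball_aut_in_bloch_A w)
    finally obtain z where z: "norm z < 1" and "ennreal (k / 2) < ennreal
       ((1 - (norm z)\<^sup>2) powr ((real CARD('n) + 1) / (2 * real CARD('n))) *
        cmod (det (cjacobian (ball_aut w \<circ> \<phi>) z)) powr (1 / real CARD('n)))"
      unfolding prenorm_A_def less_SUP_iff by auto
    then have *: "k / 2 < tau \<phi> z * (1 - (norm (ball_aut w (\<phi> z)))\<^sup>2) powr p"
      unfolding weight_compose_ball_aut[OF assms(1,2) z w]
      unfolding p_def[symmetric] using k(1) by (simp add: ennreal_less_iff)
    define y where "y = 1 - (norm (ball_aut w (\<phi> z)))\<^sup>2"
    have a: "norm (\<phi> z) < 1"
      using assms(2) z by (auto simp: image_subset_iff)
    have y: "0 < y" "y \<le> 1"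
      using one_minus_norm_square_pos[OF norm_ball_aut_less_1[OF w a]] by (simp_all add: y_def)
    have tau0: "0 \<le> tau \<phi> z"
      by (simp add: tau_def)
    have "y powr p \<le> 1"
      using powr_mono2[of p y 1] p y by simp
    then have "k / 2 \<le> tau \<phi> z"
      using * mult_left_mono[OF _ tau0, of "y powr p" 1] unfolding y_def[symmetric] by simp
    moreover have "\<eta> \<le> y"
    proof -
      \<comment> \<open>Replacing \<open>tau\<close> by its upper bound isolates the power of
        \<open>y\<close>, and a p-th root gives \<eta>.\<close>
      have "k / 2 \<le> F * y powr p"
        using * mult_right_mono[OF tau_le_fact[OF assms(1,2) z], of "y powr p"]
        unfolding y_def[symmetric] F_def by simp
      then have "k / 2 / F \<le> y powr p"
        using F by (simp add: field_simps)
      then have "\<eta> \<le> (y powr p) powr (1 / p)"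
        unfolding \<eta>_def using k(1) F p by (intro powr_mono2) auto
      then show ?thesis
        using p y by (simp add: powr_powr)
    qed
    then have "bergman_dist (\<phi> z) w \<le> C"
      unfolding C_def y_def by (intro bergman_dist_le_ball_aut a w \<eta>)
    ultimately show ?thesis
      using z by auto
  qed
  moreover have "0 < tanh C" "tanh C < 1"
    using C by (simp_all add: tanh_real_lt_1)
  ultimately show ?thesis
    using k(1) by (intro exI[of _ "k / 2"] exI[of _ "tanh C"]) auto
qed

end
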